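(* For every simply typed $\lambda$-term $M$: (1) if $M\to^* N$ in the Call-by-Name $\lambda$-calculus, then $*;M^{\mathrm n}\to^*\widehat N^{\mathrm n}$ in the ptq-calculus; (2) if $M\to^*N$ in the Call-by-Value $\lambda$-calculus, then $M^{\mathrm v}\,*\to^*\widehat N^{\mathrm v}$ in the ptq-calculus.
   Context: Call-by-Name and Call-by-Value $\lambda$-calculi (lazy, no reduction under $\lambda$; a value $V$ is a variable or an abstraction). CbN one-step: $(\lambda x.M)N\to M[N/x]$, and $M\to M_1$ implies $MN\to M_1N$. CbV one-step (argument evaluated first): $(\lambda x.M)V\to M[V/x]$ for $V$ a value; $N\to N_1$ implies $MN\to MN_1$; $M\to M_1$ implies $MV\to M_1V$ for $V$ a value. $\to^*$ denotes reflexive–transitive closure. ptq-calculus: p-variables (identified with $\lambda$-variables), a t-variable $k$, a constant $*$; p-terms $p::=x\mid\lambda\langle x,k\rangle.u\mid\lambda k.u$; t-terms $t::=*\mid k\mid\langle p,t\rangle\mid\lambda x.u$; q-terms $q::=\overline{\lambda}k.u$; e-terms $u::=t;p\mid q\,t$; binders $\lambda\langle x,k\rangle$ (binds $x,k$), $\lambda k,\overline\lambda k$ (bind $k$), $\lambda x$ (binds $x$); terms modulo $\alpha$-conversion. For $u$ with $k$ free, $u_*:=u[*/k]$; t-closed means no free t-variable. Reduction (on t-closed e-terms, only at top level): $*;\lambda k.u\to u[*/k]$; $\langle p,t_*\rangle;\lambda k.u\to u[\langle p,t_*\rangle/k]$; $\langle p,t_*\rangle;\lambda\langle x,k\rangle.u\to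 u[p/x,t_*/k]$; $(\lambda x.u_* );p\to u_*[p/x]$; $(\overline\lambda k.u)\,t_*\to u[t_*/k]$; $\to^*$ is its reflexive–transitive closure. Composition: $t_*\cdot a_*:=a_*[t_*/*]$. Translations: $x^{\mathrm n}=x$, $(\lambda x.M)^{\mathrm n}=\lambda\langle x,k\rangle.k;M^{\mathrm n}$, $(MN)^{\mathrm n}=\lambda k.\langle N^{\mathrm n},k\rangle;M^{\mathrm n}$; $x^{\mathrm v}=\overline\lambda k.k;x$, $(\lambda x.M)^{\mathrm v}=\overline\lambda k.k;(\lambda\langle x,k\rangle.M^{\mathrm v}k)$, $(MN)^{\mathrm v}=\overline\lambda k.N^{\mathrm v}(\lambda x.M^{\mathrm v}\langle x,k\rangle)$. On values: $\overline x^{\mathrm n}=\overline x^{\mathrm v}=x$, $\overline{\lambda x.M}^{\mathrm n}=\lambda\langle x,k\rangle.k;M^{\mathrm n}$, $\overline{\lambda x.M}^{\mathrm v}=\lambda\langle x,k\rangle.M^{\mathrm v}k$. E-term translations: $\widehat V^{\mathrm n}=*;\overline V^{\mathrm n}$, $\widehat{MN}^{\mathrm n}=\langle N^{\mathrm n},*\rangle\cdot\widehat M^{\mathrm n}$; $\widehat V^{\mathrm v}=*;\overline V^{\mathrm v}$, $\widehat{MV}^{\mathrm v}=\langle\overline V^{\mathrm v},*\rangle\cdot\widehat M^{\mathrm v}$ ($V$ value), $\widehat{MN}^{\mathrm v}=(\lambda x.M^{\mathrm v}\langle x,*\rangle)\cdot\widehat N^{\mathrm v}$ ($N$ not a value,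 $x$ fresh). *)

theory Defs
  imports Main
begin

text \<open>
  Terms modulo alpha-conversion are represented with de Bruijn indices.
  Typing is Curry-style, over an arbitrary type of base types.
\<close>

datatype lam = Var nat | App lam lam | Lam lam

datatype 'b ty = Base 'b | Arrow "'b ty" "'b ty"

inductive typing :: "'b ty list \<Rightarrow> lam \<Rightarrow> 'b ty \<Rightarrow> bool" where
  typing_Var: "i < length \<Gamma> \<Longrightarrow> \<Gamma> ! i = A \<Longrightarrow> typing \<Gamma> (Var i) A"
| typing_Lam: "typing (A # \<Gamma>) M B \<Longrightarrow> typing \<Gamma> (Lam M) (Arrow A B)"
| typing_App: "typing \<Gamma> M (Arrow A B) \<Longrightarrow> typing \<Gamma> N A \<Longrightarrow> typing \<Gamma> (App M N) B"

primrec is_value :: "lam \<Rightarrow> bool" where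
  "is_value (Var i) = True"
| "is_value (App M N) = False"
| "is_value (Lam M) = True"

primrec lift :: "lam \<Rightarrow> nat \<Rightarrow> lam" where
  "lift (Var i) n = (if i < n then Var i else Var (Suc i))"
| "lift (App M N) n = App (lift M n) (lift N n)"
| "lift (Lam M) n = Lam (lift M (Suc n))"

text \<open>
  Substitution for index \<open>n\<close> removes the corresponding binder, so the indices
  above \<open>n\<close> are decremented; hence \<open>M[N/x]\<close>, for \<open>M\<close> the body of a
  binder of \<open>x\<close>, is \<open>subst M N 0\<close>.
\<close>

primrec subst :: "lam \<Rightarrow> lam \<Rightarrow> nat \<Rightarrow> lam" where
  "subst (Var i) S n = (if n < i then Var (i - 1) else if i = n then S else Var i)"
| "subst (App M N) S n = App (subst M S n) (subst N S n)"
| "subst (Lam M) S n = Lam (subst M (lift S 0) (Suc n))"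

inductive cbn :: "lam \<Rightarrow> lam \<Rightarrow> bool" where
  cbn_beta: "cbn (App (Lam M) N) (subst M N 0)"
| cbn_app: "cbn M M1 \<Longrightarrow> cbn (App M N) (App M1 N)"

inductive cbv :: "lam \<Rightarrow> lam \<Rightarrow> bool" where
  cbv_beta: "is_value V \<Longrightarrow> cbv (App (Lam M) V) (subst M V 0)"
| cbv_arg: "cbv N N1 \<Longrightarrow> cbv (App M N) (App M N1)"
| cbv_fun: "is_value V \<Longrightarrow> cbv M M1 \<Longrightarrow> cbv (App M V) (App M1 V)"

text \<open>
  The p-variables are de Bruijn indices, shared with the lambda-variables. They are
  bound by \<open>PLamPair\<close> (the binder \<open>\<lambda>\<langle>x,k\<rangle>\<close>) and \<open>TLam\<close> (the binder
  \<open>\<lambda>x\<close>). There is a single t-variable \<open>k\<close>, the constructor \<open>TK\<close>, bound by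
  \<open>PLamPair\<close>, \<open>PLamK\<close> and \<open>QLamK\<close>: an occurrence of \<open>TK\<close> refers to the
  innermost of these binders above it. In particular no p-term and no q-term has
  \<open>k\<close> free.
  \<open>Cut t p\<close> is \<open>t;p\<close> and \<open>Call q t\<close> is \<open>q t\<close>.
\<close>

datatype pterm = PVar nat | PLamPair eterm | PLamK eterm
and tterm = TStar | TK | TPair pterm tterm | TLam eterm
and qterm = QLamK eterm
and eterm = Cut tterm pterm | Call qterm tterm

primrec tclosed_t :: "tterm \<Rightarrow> bool"
and tclosed_e :: "eterm \<Rightarrow> bool"
and tclosed_p :: "pterm \<Rightarrow> bool"
and tclosed_q :: "qterm \<Rightarrow> bool" where
  "tclosed_p (PVar i) = True"
| "tclosed_p (PLamPair u) = True"
| "tclosed_p (PLamK u) = True"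
| "tclosed_t TStar = True"
| "tclosed_t TK = False"
| "tclosed_t (TPair p t) = (tclosed_p p \<and> tclosed_t t)"
| "tclosed_t (TLam u) = tclosed_e u"
| "tclosed_q (QLamK u) = True"
| "tclosed_e (Cut t p) = (tclosed_t t \<and> tclosed_p p)"
| "tclosed_e (Call q t) = (tclosed_q q \<and> tclosed_t t)"

primrec lift_p :: "pterm \<Rightarrow> nat \<Rightarrow> pterm"
and lift_t :: "tterm \<Rightarrow> nat \<Rightarrow> tterm"
and lift_q :: "qterm \<Rightarrow> nat \<Rightarrow> qterm"
and lift_e :: "eterm \<Rightarrow> nat \<Rightarrow> eterm" where
  "lift_p (PVar i) n = (if i < n then PVar i else PVar (Suc i))"
| "lift_p (PLamPair u) n = PLamPair (lift_e u (Suc n))"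
| "lift_p (PLamK u) n = PLamK (lift_e u n)"
| "lift_t TStar n = TStar"
| "lift_t TK n = TK"
| "lift_t (TPair p t) n = TPair (lift_p p n) (lift_t t n)"
| "lift_t (TLam u) n = TLam (lift_e u (Suc n))"
| "lift_q (QLamK u) n = QLamK (lift_e u n)"
| "lift_e (Cut t p) n = Cut (lift_t t n) (lift_p p n)"
| "lift_e (Call q t) n = Call (lift_q q n) (lift_t t n)"

primrec subst_p :: "pterm \<Rightarrow> pterm \<Rightarrow> nat \<Rightarrow> pterm"
and subst_t :: "tterm \<Rightarrow> pterm \<Rightarrow> nat \<Rightarrow> tterm"
and subst_q :: "qterm \<Rightarrow> pterm \<Rightarrow> nat \<Rightarrow> qterm"
and subst_e :: "eterm \<Rightarrow> pterm \<Rightarrow> nat \<Rightarrow> eterm" where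
  "subst_p (PVar i) s n = (if n < i then PVar (i - 1) else if i = n then s else PVar i)"
| "subst_p (PLamPair u) s n = PLamPair (subst_e u (lift_p s 0) (Suc n))"
| "subst_p (PLamK u) s n = PLamK (subst_e u s n)"
| "subst_t TStar s n = TStar"
| "subst_t TK s n = TK"
| "subst_t (TPair p t) s n = TPair (subst_p p s n) (subst_t t s n)"
| "subst_t (TLam u) s n = TLam (subst_e u (lift_p s 0) (Suc n))"
| "subst_q (QLamK u) s n = QLamK (subst_e u s n)"
| "subst_e (Cut t p) s n = Cut (subst_t t s n) (subst_p p s n)"
| "subst_e (Call q t) s n = Call (subst_q q s n) (subst_t t s n)"

text \<open>
  Substitution of a t-term for the free occurrences of \<open>k\<close>. Subterms that are p-terms
  or q-terms are left alone, since \<open>k\<close> is never free in them.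
\<close>

fun substk_t :: "tterm \<Rightarrow> tterm \<Rightarrow> tterm"
and substk_e :: "eterm \<Rightarrow> tterm \<Rightarrow> eterm" where
  "substk_t TStar s = TStar"
| "substk_t TK s = s"
| "substk_t (TPair p t) s = TPair p (substk_t t s)"
| "substk_t (TLam u) s = TLam (substk_e u (lift_t s 0))"
| "substk_e (Cut t p) s = Cut (substk_t t s) p"
| "substk_e (Call q t) s = Call q (substk_t t s)"

text \<open>
  In the third rule, performing the two substitutions one after the other is the
  simultaneous substitution \<open>u[p/x,t/k]\<close>: \<open>k\<close> is not free in \<open>p\<close>, and the
  t-term \<open>t\<close>, which lives outside the binder of \<open>x\<close>, is inserted last.
\<close>

inductive ptq :: "eterm \<Rightarrow> eterm \<Rightarrow> bool" where
  ptq_star: "ptq (Cut TStar (PLamK u)) (substk_e u TStar)"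
| ptq_pair: "tclosed_t t \<Longrightarrow> ptq (Cut (TPair p t) (PLamK u)) (substk_e u (TPair p t))"
| ptq_pair_pair:
    "tclosed_t t \<Longrightarrow> ptq (Cut (TPair p t) (PLamPair u)) (substk_e (subst_e u p 0) t)"
| ptq_lam: "tclosed_e u \<Longrightarrow> ptq (Cut (TLam u) p) (subst_e u p 0)"
| ptq_call: "tclosed_t t \<Longrightarrow> ptq (Call (QLamK u) t) (substk_e u t)"

text \<open>
  Substitution of a t-term for the constant \<open>*\<close>. It is only meaningful for t-closed
  \<open>s\<close>, as a free \<open>k\<close> of \<open>s\<close> would be captured by the binders of \<open>k\<close>.
\<close>

primrec substs_p :: "pterm \<Rightarrow> tterm \<Rightarrow> pterm"
and substs_t :: "tterm \<Rightarrow> tterm \<Rightarrow> tterm"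
and substs_q :: "qterm \<Rightarrow> tterm \<Rightarrow> qterm"
and substs_e :: "eterm \<Rightarrow> tterm \<Rightarrow> eterm" where
  "substs_p (PVar i) s = PVar i"
| "substs_p (PLamPair u) s = PLamPair (substs_e u (lift_t s 0))"
| "substs_p (PLamK u) s = PLamK (substs_e u s)"
| "substs_t TStar s = s"
| "substs_t TK s = TK"
| "substs_t (TPair p t) s = TPair (substs_p p s) (substs_t t s)"
| "substs_t (TLam u) s = TLam (substs_e u (lift_t s 0))"
| "substs_q (QLamK u) s = QLamK (substs_e u s)"
| "substs_e (Cut t p) s = Cut (substs_t t s) (substs_p p s)"
| "substs_e (Call q t) s = Call (substs_q q s) (substs_t t s)"

definition compose :: "tterm \<Rightarrow> eterm \<Rightarrow> eterm" where
  "compose t a = substs_e a t"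

primrec trans_n :: "lam \<Rightarrow> pterm" where
  "trans_n (Var i) = PVar i"
| "trans_n (Lam M) = PLamPair (Cut TK (trans_n M))"
| "trans_n (App M N) = PLamK (Cut (TPair (trans_n N) TK) (trans_n M))"

text \<open>
  In the application case, \<open>M\<close> is placed below a binder of a fresh variable \<open>x\<close>:
  its translation is lifted, and \<open>x\<close> is the index 0.
\<close>

primrec trans_v :: "lam \<Rightarrow> qterm" where
  "trans_v (Var i) = QLamK (Cut TK (PVar i))"
| "trans_v (Lam M) = QLamK (Cut TK (PLamPair (Call (trans_v M) TK)))"
| "trans_v (App M N) =
     QLamK (Call (trans_v N) (TLam (Call (lift_q (trans_v M) 0) (TPair (PVar 0) TK))))"

text \<open>On applications, these are left unspecified.\<close>

fun val_n :: "lam \<Rightarrow> pterm" where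
  "val_n (Var i) = PVar i"
| "val_n (Lam M) = PLamPair (Cut TK (trans_n M))"

fun val_v :: "lam \<Rightarrow> pterm" where
  "val_v (Var i) = PVar i"
| "val_v (Lam M) = PLamPair (Call (trans_v M) TK)"

primrec hat_n :: "lam \<Rightarrow> eterm" where
  "hat_n (Var i) = Cut TStar (val_n (Var i))"
| "hat_n (Lam M) = Cut TStar (val_n (Lam M))"
| "hat_n (App M N) = compose (TPair (trans_n N) TStar) (hat_n M)"

primrec hat_v :: "lam \<Rightarrow> eterm" where
  "hat_v (Var i) = Cut TStar (val_v (Var i))"
| "hat_v (Lam M) = Cut TStar (val_v (Lam M))"
| "hat_v (App M N) =
     (if is_value N then compose (TPair (val_v N) TStar) (hat_v M)
      else compose (TLam (Call (lift_q (trans_v M) 0) (TPair (PVar 0) TStar))) (hat_v N))"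

end

theory Submission
  imports Defs
begin

text \<open>
  The one-step simulation is proved with an arbitrary t-closed t-term \<open>t\<close> in place of
  \<open>*\<close>: the compositions of \<open>t\<close> with translated terms are the states of an abstract
  machine with current stack \<open>t\<close>. In this form the contextual rules of both calculi reduce
  to the induction hypothesis, because \<open>t \<cdot> (s \<cdot> a) = (t \<cdot> s) \<cdot> a\<close> turns an evaluation
  context into a longer stack; only a Call-by-Value argument that has just become a value needs
  one more step, which passes it to the function.
  A beta-step is one ptq-step, which leads to the translation of the contractum in front of
  \<open>t\<close>; the administrative steps then unfold this translation until its head value is reached.
\<close>

section \<open>Commutation of lifting and substitution, and associativity of composition\<close>

lemma lift_lift_ptq:
  "i \<le> n \<Longrightarrow> lift_p (lift_p p n) i = lift_p (lift_p p i) (Suc n)"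
  "i \<le> n \<Longrightarrow> lift_t (lift_t t n) i = lift_t (lift_t t i) (Suc n)"
  "i \<le> n \<Longrightarrow> lift_q (lift_q q n) i = lift_q (lift_q q i) (Suc n)"
  "i \<le> n \<Longrightarrow> lift_e (lift_e u n) i = lift_e (lift_e u i) (Suc n)"
  by (induction p and t and q and u arbitrary: n i and n i and n i and n i) auto

lemma subst_lift_ptq [simp]:
  "subst_p (lift_p p n) s n = p"
  "subst_t (lift_t t n) s n = t"
  "subst_q (lift_q q n) s n = q"
  "subst_e (lift_e u n) s n = u"
  by (induction p and t and q and u arbitrary: s n and s n and s n and s n) auto

lemma lift_subst_ptq:
  "i \<le> n \<Longrightarrow> lift_p (subst_p p s n) i = subst_p (lift_p p i) (lift_p s i) (Suc n)"
  "i \<le> n \<Longrightarrow> lift_t (subst_t t s n) i = subst_t (lift_t t i) (lift_p s i) (Suc n)"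
  "i \<le> n \<Longrightarrow> lift_q (subst_q q s n) i = subst_q (lift_q q i) (lift_p s i) (Suc n)"
  "i \<le> n \<Longrightarrow> lift_e (subst_e u s n) i = subst_e (lift_e u i) (lift_p s i) (Suc n)"
  by (induction p and t and q and u arbitrary: s n i and s n i and s n i and s n i)
    (auto simp: lift_lift_ptq(1))

lemma lift_substs_ptq:
  "lift_p (substs_p p s) n = substs_p (lift_p p n) (lift_t s n)"
  "lift_t (substs_t t s) n = substs_t (lift_t t n) (lift_t s n)"
  "lift_q (substs_q q s) n = substs_q (lift_q q n) (lift_t s n)"
  "lift_e (substs_e u s) n = substs_e (lift_e u n) (lift_t s n)"
  by (induction p and t and q and u arbitrary: s n and s n and s n and s n)
    (auto simp: lift_lift_ptq(2))

text \<open>The first substitution replaces every \<open>*\<close>, so the second one can only reach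
  the \<open>*\<close> inside the inserted copies of \<open>s\<close>.\<close>

lemma substs_substs_ptq:
  "substs_p (substs_p p s) t = substs_p p (substs_t s t)"
  "substs_t (substs_t r s) t = substs_t r (substs_t s t)"
  "substs_q (substs_q q s) t = substs_q q (substs_t s t)"
  "substs_e (substs_e u s) t = substs_e u (substs_t s t)"
  by (induction p and r and q and u arbitrary: s t and s t and s t and s t)
    (auto simp: lift_substs_ptq(2))

lemma compose_compose: "compose t (compose s a) = compose (substs_t s t) a"
  by (simp add: compose_def substs_substs_ptq)

lemma tclosed_lift [simp]:
  "tclosed_p (lift_p p n) = tclosed_p p"
  "tclosed_t (lift_t t n) = tclosed_t t"
  "tclosed_q (lift_q q n) = tclosed_q q"
  "tclosed_e (lift_e u n) = tclosed_e u"
  by (induction p and t and q and u arbitrary: n and n and n and n) auto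

text \<open>A p-term is a variable or starts with a binder of \<open>k\<close>.\<close>

lemma tclosed_p [simp]: "tclosed_p p"
  by (cases p) auto

lemma tclosed_q [simp]: "tclosed_q q"
  by (cases q) auto

section \<open>Call-by-Name simulation\<close>

lemma trans_n_lift: "trans_n (lift M n) = lift_p (trans_n M) n"
  by (induction M arbitrary: n) auto

lemma trans_n_subst: "trans_n (subst M N n) = subst_p (trans_n M) (trans_n N) n"
  by (induction M arbitrary: N n) (auto simp: trans_n_lift)

text \<open>The constant \<open>*\<close> does not occur in translations, so composing with a stack
  extends only the stack.\<close>

lemma substs_trans_n [simp]: "substs_p (trans_n M) s = trans_n M"
  by (induction M arbitrary: s) auto

text \<open>
  Stacks of the form \<open>\<lambda>x.u\<close> are excluded: they do not trigger the reduction of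
  \<open>\<lambda>k.u\<close>.
\<close>

fun cbn_stack :: "tterm \<Rightarrow> bool" where
  "cbn_stack (TPair p t) = tclosed_t t"
| "cbn_stack t = (t = TStar)"

lemma cbn_stack_tclosed: "cbn_stack t \<Longrightarrow> tclosed_t t"
  by (cases t) auto

lemma ptq_cbn_stack: "cbn_stack t \<Longrightarrow> ptq (Cut t (PLamK u)) (substk_e u t)"
  by (cases t) (auto intro: ptq.intros)

text \<open>Each application on the spine pushes its argument, which leaves a pair as the stack for
  the function; at a value both sides coincide.\<close>

lemma trans_n_hat_n:
  "cbn_stack t \<Longrightarrow> ptq\<^sup>*\<^sup>* (Cut t (trans_n M)) (compose t (hat_n M))"
proof (induction M arbitrary: t)
  case (App M N)
  have "ptq (Cut t (trans_n (App M N))) (Cut (TPair (trans_n N) t) (trans_n M))"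
    using ptq_cbn_stack[OF App.prems, of "Cut (TPair (trans_n N) TK) (trans_n M)"] by simp
  moreover have "ptq\<^sup>*\<^sup>* (Cut (TPair (trans_n N) t) (trans_n M))
      (compose (TPair (trans_n N) t) (hat_n M))"
    using App.IH(1) cbn_stack_tclosed[OF App.prems] by simp
  ultimately show ?case
    by (simp add: compose_compose)
qed (simp_all add: compose_def)

lemma cbn_simulation:
  "cbn M N \<Longrightarrow> cbn_stack t \<Longrightarrow> ptq\<^sup>*\<^sup>* (compose t (hat_n M)) (compose t (hat_n N))"
proof (induction arbitrary: t rule: cbn.induct)
  case (cbn_beta M N)
  have "ptq (Cut (TPair (trans_n N) t) (trans_n (Lam M))) (Cut t (trans_n (subst M N 0)))"
    using ptq_pair_pair[OF cbn_stack_tclosed[OF cbn_beta], of "trans_n N" "Cut TK (trans_n M)"]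
    by (simp add: trans_n_subst)
  then show ?case
    using trans_n_hat_n[OF cbn_beta, of "subst M N 0"] by (simp add: compose_def)
next
  case (cbn_app M M1 N)
  then show ?case
    using cbn_stack_tclosed[OF cbn_app.prems] by (simp add: compose_compose)
qed

section \<open>Call-by-Value simulation\<close>

lemma trans_v_lift: "trans_v (lift M n) = lift_q (trans_v M) n"
  by (induction M arbitrary: n) (auto simp: lift_lift_ptq)

lemma is_value_lift [simp]: "is_value (lift M n) = is_value M"
  by (cases M) auto

lemma val_v_lift: "is_value V \<Longrightarrow> val_v (lift V n) = lift_p (val_v V) n"
  by (cases V) (auto simp: trans_v_lift)

lemma trans_v_value: "is_value V \<Longrightarrow> trans_v V = QLamK (Cut TK (val_v V))"
  by (cases V) auto

lemma hat_v_value: "is_value V \<Longrightarrow> hat_v V = Cut TStar (val_v V)"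
  by (cases V) auto

text \<open>A variable \<open>x\<close> becomes \<open>k;x\<close>, so only a p-term can be inserted
  for it. For a value \<open>V\<close>, inserting \<open>val_v V\<close> yields exactly
  \<open>trans_v V\<close>.\<close>

lemma trans_v_subst:
  "is_value V \<Longrightarrow> trans_v (subst M V n) = subst_q (trans_v M) (val_v V) n"
  by (induction M arbitrary: V n) (auto simp: val_v_lift trans_v_value lift_subst_ptq)

lemma substs_trans_v [simp]: "substs_q (trans_v M) s = trans_v M"
  \<comment> \<open>In an application the function stands under a lift; moving the lift outwards
    exposes the induction hypothesis.\<close>
  by (induction M arbitrary: s) (auto simp: lift_substs_ptq(3)[symmetric])

lemma substs_lift_trans_v [simp]: "substs_q (lift_q (trans_v M) n) s = lift_q (trans_v M) n"
  by (simp add: trans_v_lift[symmetric])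

lemma substs_val_v [simp]: "is_value V \<Longrightarrow> substs_p (val_v V) s = val_v V"
  by (cases V) auto

text \<open>The stack during the evaluation of an argument of \<open>M\<close>: it waits for the
  value, then calls \<open>M\<close> with that value pushed on \<open>t\<close>.\<close>

abbreviation arg_stack :: "lam \<Rightarrow> tterm \<Rightarrow> tterm" where
  "arg_stack M t \<equiv> TLam (Call (lift_q (trans_v M) 0) (TPair (PVar 0) (lift_t t 0)))"

lemma hat_v_App:
  "compose t (hat_v (App M N)) =
    (if is_value N then compose (TPair (val_v N) t) (hat_v M)
     else compose (arg_stack M t) (hat_v N))"
  by (simp add: compose_compose)

text \<open>The second assumption is an induction hypothesis in \<open>trans_v_hat_v\<close>, and an
  instance of that lemma in \<open>cbv_simulation\<close>. If \<open>N\<close> is not a value, both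
  ends are equal.\<close>

lemma arg_stack_hat_v:
  assumes "tclosed_t t"
    and "ptq\<^sup>*\<^sup>* (Call (trans_v M) (TPair (val_v N) t)) (compose (TPair (val_v N) t) (hat_v M))"
  shows "ptq\<^sup>*\<^sup>* (compose (arg_stack M t) (hat_v N)) (compose t (hat_v (App M N)))"
proof (cases "is_value N")
  case True
  \<comment> \<open>Substituting for index 0 cancels the lifts of \<open>trans_v M\<close> and
    \<open>t\<close>.\<close>
  have "ptq (Cut (arg_stack M t) (val_v N)) (Call (trans_v M) (TPair (val_v N) t))"
    using ptq_lam[of "Call (lift_q (trans_v M) 0) (TPair (PVar 0) (lift_t t 0))" "val_v N"]
      assms(1) by simp
  then show ?thesis
    using assms(2) True unfolding hat_v_App by (simp add: hat_v_value compose_def)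
next
  case False
  then show ?thesis
    by (simp add: hat_v_App del: hat_v.simps)
qed

lemma trans_v_hat_v:
  "tclosed_t t \<Longrightarrow> ptq\<^sup>*\<^sup>* (Call (trans_v M) t) (compose t (hat_v M))"
proof (induction M arbitrary: t)
  case (Var i)
  then show ?case
    using ptq_call[OF Var, of "Cut TK (PVar i)"] by (simp add: compose_def r_into_rtranclp)
next
  case (App M N)
  \<comment> \<open>\<open>arg_stack M TK\<close> is the stack built into the translation; replacing
    \<open>k\<close> under its binder lifts \<open>t\<close>.\<close>
  have "ptq (Call (trans_v (App M N)) t) (Call (trans_v N) (arg_stack M t))"
    using ptq_call[OF App.prems, of "Call (trans_v N) (arg_stack M TK)"] by simp
  moreover have "ptq\<^sup>*\<^sup>* (Call (trans_v N) (arg_stack M t)) (compose (arg_stack M t) (hat_v N))"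
    using App.IH(2) App.prems by simp
  moreover have "ptq\<^sup>*\<^sup>* (compose (arg_stack M t) (hat_v N)) (compose t (hat_v (App M N)))"
    using arg_stack_hat_v App.IH(1) App.prems by simp
  ultimately show ?case
    by (meson converse_rtranclp_into_rtranclp rtranclp_trans)
next
  case (Lam M)
  then show ?case
    using ptq_call[OF Lam.prems, of "Cut TK (val_v (Lam M))"]
    by (simp add: compose_def r_into_rtranclp)
qed

lemma cbv_not_value: "cbv M N \<Longrightarrow> \<not> is_value M"
  by (induction rule: cbv.induct) auto

lemma cbv_simulation:
  "cbv M N \<Longrightarrow> tclosed_t t \<Longrightarrow> ptq\<^sup>*\<^sup>* (compose t (hat_v M)) (compose t (hat_v N))"
proof (induction arbitrary: t rule: cbv.induct)
  case (cbv_beta V M)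
  have "ptq (Cut (TPair (val_v V) t) (val_v (Lam M))) (Call (trans_v (subst M V 0)) t)"
    using ptq_pair_pair[OF cbv_beta.prems, of "val_v V" "Call (trans_v M) TK"] cbv_beta.hyps
    by (simp add: trans_v_subst)
  then show ?case
    using trans_v_hat_v[OF cbv_beta.prems, of "subst M V 0"] cbv_beta.hyps
    by (simp add: compose_def)
next
  case (cbv_arg N N1 M)
  have "ptq\<^sup>*\<^sup>* (compose (arg_stack M t) (hat_v N)) (compose (arg_stack M t) (hat_v N1))"
    using cbv_arg by simp
  \<comment> \<open>If \<open>N1\<close> is a value, the target has it paired with \<open>t\<close>
    already and \<open>M\<close> unfolded.\<close>
  moreover have "ptq\<^sup>*\<^sup>* (compose (arg_stack M t) (hat_v N1)) (compose t (hat_v (App M N1)))"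
    using arg_stack_hat_v trans_v_hat_v cbv_arg.prems by simp
  ultimately show ?case
    using cbv_not_value[OF cbv_arg.hyps] by (simp add: hat_v_App del: hat_v.simps)
next
  case (cbv_fun V M M1)
  then show ?case
    by (simp add: hat_v_App del: hat_v.simps)
qed

text \<open>Composition with \<open>*\<close> is the identity, so the simulations at
  \<open>t = *\<close> speak of the plain e-term translations.\<close>

lemma substs_TStar [simp]:
  "substs_p p TStar = p"
  "substs_t t TStar = t"
  "substs_q q TStar = q"
  "substs_e u TStar = u"
  by (induction p and t and q and u) auto

theorem theorem3:
  fixes M :: lam and \<Gamma> :: "'b ty list" and A :: "'b ty"
  assumes "typing \<Gamma> M A"
  shows "(\<forall>N. cbn\<^sup>*\<^sup>* M N \<longrightarrow> ptq\<^sup>*\<^sup>* (Cut TStar (trans_n M)) (hat_n N)) \<and>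
         (\<forall>N. cbv\<^sup>*\<^sup>* M N \<longrightarrow> ptq\<^sup>*\<^sup>* (Call (trans_v M) TStar) (hat_v N))"
proof (intro conjI allI impI)
  fix N
  show "ptq\<^sup>*\<^sup>* (Cut TStar (trans_n M)) (hat_n N)" if "cbn\<^sup>*\<^sup>* M N"
    using that
  proof (induction rule: rtranclp_induct)
    \<comment> \<open>Administrative steps alone reach the translation of \<open>M\<close>.\<close>
    case base
    then show ?case using trans_n_hat_n[of TStar M] by (simp add: compose_def)
  next
    case (step N N')
    then show ?case using cbn_simulation[of N N' TStar] by (simp add: compose_def)
  qed
  show "ptq\<^sup>*\<^sup>* (Call (trans_v M) TStar) (hat_v N)" if "cbv\<^sup>*\<^sup>* M N"
    using that
  proof (induction rule: rtranclp_induct)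
    case base
    then show ?case using trans_v_hat_v[of TStar M] by (simp add: compose_def)
  next
    case (step N N')
    then show ?case using cbv_simulation[of N N' TStar] by (simp add: compose_def)
  qed
qed

end
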